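(* Let $a,b,c,w,x,y$ be six distinct spin orbitals, and let $\eta_1,\eta_2$ be two further distinct (ancilla) spin orbitals. Let $\theta\in\mathbb{R}$. Let $$\ket{\Psi}=\xi_1\ket{abc}+\xi_2\ket{ab\phi_1}+\xi_3\ket{c\phi_2\phi_3}+\xi_4\ket{wxy},$$ where $\xi_1,\dots,\xi_4$ are arbitrary coefficients and $\phi_1,\phi_2,\phi_3$ are orbitals not in $\{a,b,c,w,x,y,\eta_1,\eta_2\}$ with $\phi_2\neq\phi_3$ (so the ancilla orbitals are empty in $\ket{\Psi}$). Then two double factors, two single factors and one singly controlled double factor reproduce the triple unitary coupled-cluster factor on $\ket{\Psi}$: $$U^{ab}_{w\eta_1}(\tfrac{\pi}{2})\,U^{c}_{\eta_2}(\tfrac{\pi}{2})\,C_{w}U^{xy}_{\eta_1\eta_2}(\theta)\,U^{\eta_2}_{c}(\tfrac{\pi}{2})\,U^{w\eta_1}_{ab}(\tfrac{\pi}{2})\ket{\Psi}=e^{\theta\left(\hat A_{abc}^{wxy}-(\hat A_{abc}^{wxy})^\dagger\right)}\ket{\Psi},$$ and both sides equal $$\xi_1(\cos\theta\ket{abc}+\sin\theta\ket{wxy})+\xi_2\ket{ab\phi_1}+\xi_3\ket{c\phi_2\phi_3}+\xi_4(\cos\theta\ket{wxy}-\sin\theta\ket{abc}).$$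
   Context: Work in the fermionic Fock space over a finite set of spin orbitals with creation and annihilation operators $\hat a_p^\dagger,\hat a_p$ satisfying $\{\hat a_p,\hat a_q\}=0$, $\{\hat a_p^\dagger,\hat a_q^\dagger\}=0$, $\{\hat a_p,\hat a_q^\dagger\}=\delta_{pq}$, vacuum $\ket{\mathrm{vac}}$ and number operators $\hat n_p=\hat a_p^\dagger\hat a_p$. A ket listing orbitals denotes the determinant $\ket{p_1p_2\cdots p_m}=\hat a_{p_1}^\dagger\hat a_{p_2}^\dagger\cdots\hat a_{p_m}^\dagger\ket{\mathrm{vac}}$; all orbitals not listed are empty. For disjoint lists of distinct orbitals $i_1,\dots,i_n$ and $p_1,\dots,p_n$, the rank-$n$ excitation operator is $\hat A_{i_1\cdots i_n}^{p_1\cdots p_n}=\hat a_{p_1}^\dagger\hat a_{p_2}^\dagger\cdots\hat a_{p_n}^\dagger\,\hat a_{i_n}\cdots\hat a_{i_2}\hat a_{i_1}$. The corresponding unitary coupled-cluster (UCC) factor with angle $\theta$ is $U_{i_1\cdots i_n}^{p_1\cdots p_n}(\theta)=\exp\!\big(\theta[\hat A_{i_1\cdots i_n}^{p_1\cdots p_n}-(\hat A_{i_1\cdots i_n}^{p_1\cdots p_n})^\dagger]\big)$. The controlled factor $C_{q_1\cdots q_k}U_{i_1\cdots i_n}^{p_1\cdots p_n}(\theta)$, with control orbitals $q_1,\dots,q_k$ distinct from all $i$'s and $p$'s, acts as $U_{i_1\cdots i_n}^{p_1\cdots p_n}(\theta)$ on determinants in which all of $q_1,\dots,q_k$ are occupied,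 and as the identity on all other determinants; equivalently it is $\exp\!\big(\theta\,\hat n_{q_1}\cdots\hat n_{q_k}[\hat A_{i_1\cdots i_n}^{p_1\cdots p_n}-(\hat A_{i_1\cdots i_n}^{p_1\cdots p_n})^\dagger]\big)$. *)

theory Defs
  imports "HOL-Analysis.Analysis"
begin

text \<open>
  The spin orbitals are the elements of a finite type \<open>'o\<close>. Occupation-number representation:
  a vector assigns an amplitude to every set of occupied orbitals. The linear order on \<open>'o\<close> only
  fixes the Jordan-Wigner signs.
\<close>

type_synonym 'o fock = "complex ^ ('o set)"

definition vac :: "('o::{finite,linorder}) fock" where
  "vac = axis {} 1"

definition jw_sign :: "'o::{finite,linorder} \<Rightarrow> 'o set \<Rightarrow> complex" where
  "jw_sign p S = (- 1) ^ card {q \<in> S. q < p}"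

definition annihilate :: "'o::{finite,linorder} \<Rightarrow> 'o fock \<Rightarrow> 'o fock" where
  "annihilate p v = (\<chi> S. if p \<in> S then 0 else jw_sign p S * v $ insert p S)"

definition create :: "'o::{finite,linorder} \<Rightarrow> 'o fock \<Rightarrow> 'o fock" where
  "create p v = (\<chi> S. if p \<in> S then jw_sign p S * v $ (S - {p}) else 0)"

definition number :: "'o::{finite,linorder} \<Rightarrow> 'o fock \<Rightarrow> 'o fock" where
  "number p v = create p (annihilate p v)"

definition ket :: "'o::{finite,linorder} list \<Rightarrow> 'o fock" where
  "ket ps = foldr create ps vac"

text \<open>
  The exponential series of a linear operator, applied to a vector; see \<open>op_exp_sums\<close> for convergence.
\<close>

definition op_exp :: "('v \<Rightarrow> 'v) \<Rightarrow> 'v \<Rightarrow> 'v::real_normed_vector" where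
  "op_exp X v = (\<Sum>n. (X ^^ n) v /\<^sub>R fact n)"

text \<open>
  \<open>excite [i\<^sub>1,\<dots>,i\<^sub>n] [p\<^sub>1,\<dots>,p\<^sub>n]\<close> has the lower indices \<open>i\<close> (annihilated) first and the
  upper indices \<open>p\<close> (created) second; as an operator product the annihilators appear in reversed order.
\<close>

definition excite :: "'o::{finite,linorder} list \<Rightarrow> 'o list \<Rightarrow> 'o fock \<Rightarrow> 'o fock" where
  "excite hs ps v = foldr create ps (foldr annihilate (rev hs) v)"

text \<open>
  The library's \<^const>\<open>adjoint\<close> refers to the real inner product, which here is the real part of the
  Hermitian one; for complex-linear operators it is therefore the Hermitian adjoint.
\<close>

definition generator :: "'o::{finite,linorder} list \<Rightarrow> 'o list \<Rightarrow> 'o fock \<Rightarrow> 'o fock" where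
  "generator hs ps v = excite hs ps v - adjoint (excite hs ps) v"

definition ucc :: "'o::{finite,linorder} list \<Rightarrow> 'o list \<Rightarrow> real \<Rightarrow> 'o fock \<Rightarrow> 'o fock" where
  "ucc hs ps \<theta> = op_exp (\<lambda>v. \<theta> *\<^sub>R generator hs ps v)"

definition controlled_ucc ::
    "'o::{finite,linorder} list \<Rightarrow> 'o list \<Rightarrow> 'o list \<Rightarrow> real \<Rightarrow> 'o fock \<Rightarrow> 'o fock" where
  "controlled_ucc qs hs ps \<theta> = op_exp (\<lambda>v. \<theta> *\<^sub>R foldr number qs (generator hs ps v))"

lemma op_exp_sums:
  fixes X :: "'v::euclidean_space \<Rightarrow> 'v"
  assumes "linear X"
  shows "(\<lambda>n. (X ^^ n) v /\<^sub>R fact n) sums op_exp X v"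
proof -
  obtain B where B: "B > 0" "\<And>x. norm (X x) \<le> B * norm x"
    using linear_bounded_pos[OF assms] by blast
  have "norm ((X ^^ n) v) \<le> B ^ n * norm v" for n
  proof (induction n)
    case (Suc n)
    have "norm ((X ^^ Suc n) v) \<le> B * norm ((X ^^ n) v)"
      using B(2) by simp
    also have "\<dots> \<le> B * (B ^ n * norm v)"
      using Suc B(1) by (intro mult_left_mono) auto
    finally show ?case by (simp add: mult.assoc)
  qed simp
  then have "norm ((X ^^ n) v /\<^sub>R fact n) \<le> B ^ n /\<^sub>R fact n * norm v" for n
    by (simp add: divide_simps)
  then have "summable (\<lambda>n. (X ^^ n) v /\<^sub>R fact n)"
    by (intro summable_comparison_test[OF _ summable_mult2[OF summable_exp_generic[of B], of "norm v"]]) auto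
  then show ?thesis
    unfolding op_exp_def by (rule summable_sums)
qed

lemma jw_sign_same [simp]:
  "jw_sign p (insert p S) = jw_sign p S" "jw_sign p (S - {p}) = jw_sign p S"
  unfolding jw_sign_def by (rule arg_cong[where f = "\<lambda>A. (- 1) ^ card A"], force)+

lemma jw_sign_square [simp]: "jw_sign p S * jw_sign p S = 1"
  by (simp add: jw_sign_def flip: power_mult_distrib)

lemma jw_sign_insert:
  "q \<notin> S \<Longrightarrow> jw_sign p (insert q S) = (if q < p then - jw_sign p S else jw_sign p S)"
proof -
  assume "q \<notin> S"
  moreover have "{r \<in> insert q S. r < p} =
      (if q < p then insert q {r \<in> S. r < p} else {r \<in> S. r < p})"
    by auto
  ultimately show ?thesis by (simp add: jw_sign_def)
qed

lemma jw_sign_remove: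
  "q \<in> S \<Longrightarrow> jw_sign p (S - {q}) = (if q < p then - jw_sign p S else jw_sign p S)"
  using jw_sign_insert[of q "S - {q}" p] by (auto simp: insert_absorb)

lemma anticomm_annihilate: "annihilate p (annihilate q v) + annihilate q (annihilate p v) = 0"
  by (auto simp: vec_eq_iff annihilate_def jw_sign_insert insert_commute not_less
      dest: less_asym intro: antisym)

lemma anticomm_create: "create p (create q v) + create q (create p v) = 0"
proof -
  have *: "S - {p} - {q} = S - {q} - {p}" for S :: "'a set" by auto
  show ?thesis
    by (auto simp: vec_eq_iff create_def jw_sign_remove * not_less
      dest: less_asym intro: antisym)
qed

lemma anticomm_annihilate_create:
  "annihilate p (create q v) + create q (annihilate p v) = (if p = q then v else 0)"
proof (cases "p = q")
  case True
  then show ?thesis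
    by (auto simp: vec_eq_iff annihilate_def create_def insert_absorb simp flip: mult.assoc)
next
  case False
  then have "insert p S - {q} = insert p (S - {q})" for S by auto
  with False show ?thesis
    by (auto simp: vec_eq_iff annihilate_def create_def jw_sign_insert jw_sign_remove not_less
      dest: less_asym intro: antisym)
qed

lemma annihilate_vac [simp]: "annihilate p vac = 0"
  by (simp add: vec_eq_iff annihilate_def vac_def axis_def)

lemma linear_annihilate: "linear (annihilate p)"
  by (rule linearI) (auto simp: vec_eq_iff annihilate_def algebra_simps)

lemma linear_create: "linear (create p)"
  by (rule linearI) (auto simp: vec_eq_iff create_def algebra_simps)

lemma annihilate_scale: "annihilate p (c *s v) = c *s annihilate p v"
  by (simp add: vec_eq_iff annihilate_def)

lemma create_scale: "create p (c *s v) = c *s create p v"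
  by (simp add: vec_eq_iff create_def)

lemma number_nth: "number p v $ S = (if p \<in> S then v $ S else 0)"
  by (simp add: number_def create_def annihilate_def insert_absorb flip: mult.assoc)

lemma inner_create_annihilate: "create p u \<bullet> v = u \<bullet> annihilate p v"
proof -
  have re: "(jw_sign p S * a) \<bullet> b = a \<bullet> (jw_sign p S * b)" for S and a b :: complex
    by (cases "even (card {q \<in> S. q < p})") (simp_all add: jw_sign_def)
  have "create p u \<bullet> v = (\<Sum>S\<in>{S. p \<in> S}. (create p u $ S) \<bullet> (v $ S))"
    unfolding inner_vec_def by (rule sum.mono_neutral_right) (auto simp: create_def)
  also have "\<dots> = (\<Sum>S\<in>{S. p \<notin> S}. (u $ S) \<bullet> (annihilate p v $ S))"
    by (rule sum.reindex_bij_witness[of _ "insert p" "\<lambda>S. S - {p}"])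
      (auto simp: create_def annihilate_def re insert_absorb)
  also have "\<dots> = u \<bullet> annihilate p v"
    unfolding inner_vec_def by (rule sum.mono_neutral_left) (auto simp: annihilate_def)
  finally show ?thesis .
qed

lemma adjoint_annihilate: "adjoint (annihilate p) = create p"
  by (rule adjoint_unique) (metis inner_commute inner_create_annihilate)

lemma adjoint_excite: "adjoint (excite hs ps) = excite ps hs"
proof -
  have c: "foldr create xs u \<bullet> v = u \<bullet> foldr annihilate (rev xs) v" for xs :: "'a list" and u v
    by (induction xs arbitrary: v) (simp_all add: inner_create_annihilate)
  show ?thesis
    by (rule adjoint_unique) (metis c excite_def inner_commute)
qed

lemma linear_excite: "linear (excite hs ps)"
proof -
  have f: "linear (foldr f xs)" if "\<And>p. linear (f p)"
    for f :: "'a \<Rightarrow> 'a fock \<Rightarrow> 'a fock" and xs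
    using that by (induction xs) (auto intro: linear_compose simp: linear_id)
  have "linear (foldr create ps \<circ> foldr annihilate (rev hs))"
    by (intro linear_compose f linear_annihilate linear_create)
  moreover have "excite hs ps = foldr create ps \<circ> foldr annihilate (rev hs)"
    by (simp add: fun_eq_iff excite_def)
  ultimately show ?thesis by simp
qed

lemma linear_generator: "linear (generator hs ps)"
  unfolding generator_def [abs_def] adjoint_excite by (intro linear_compose_sub linear_excite)

text \<open>
  The controlled factor acts as \<^const>\<open>ucc\<close> on vectors supported on occupied controls and as the
  identity on vectors with some control orbital empty.
\<close>

lemma number_excite:
  assumes "q \<notin> set hs" "q \<notin> set ps"
  shows "number q (excite hs ps v) = excite hs ps (number q v)"
proof -
  have a: "number q (annihilate p u) = annihilate p (number q u)" if "p \<noteq> q" for p u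
    using that by (auto simp: vec_eq_iff number_nth annihilate_def)
  have c: "number q (create p u) = create p (number q u)" if "p \<noteq> q" for p u
    using that by (auto simp: vec_eq_iff number_nth create_def)
  have fa: "number q (foldr annihilate xs u) = foldr annihilate xs (number q u)"
    if "q \<notin> set xs" for xs u
    using that by (induction xs) (auto simp: a)
  have fc: "number q (foldr create xs u) = foldr create xs (number q u)"
    if "q \<notin> set xs" for xs u
    using that by (induction xs) (auto simp: c)
  show ?thesis
    using assms by (simp add: excite_def fa fc)
qed

lemma number_generator:
  assumes "q \<notin> set hs" "q \<notin> set ps"
  shows "number q (generator hs ps v) = generator hs ps (number q v)"
proof -
  have "number q (x - y) = number q x - number q y" for x y
    by (simp add: vec_eq_iff number_nth)
  then show ?thesis
    using assms by (simp add: generator_def adjoint_excite number_excite)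
qed

lemma controlled_ucc_occupied:
  assumes "set qs \<inter> (set hs \<union> set ps) = {}" "\<And>q. q \<in> set qs \<Longrightarrow> number q v = v"
  shows "controlled_ucc qs hs ps \<theta> v = ucc hs ps \<theta> v"
proof -
  let ?G = "\<lambda>v. \<theta> *\<^sub>R generator hs ps v"
  let ?C = "\<lambda>v. \<theta> *\<^sub>R foldr number qs (generator hs ps v)"
  have scale: "number q (r *\<^sub>R u) = r *\<^sub>R number q u" for q r and u :: "'a fock"
    by (simp add: vec_eq_iff number_nth)
  have fixp: "foldr number xs u = u" if "\<And>q. q \<in> set xs \<Longrightarrow> number q u = u" for xs and u :: "'a fock"
    using that by (induction xs) auto
  have "number q ((?G ^^ n) v) = (?G ^^ n) v" if "q \<in> set qs" for n q
  proof (induction n)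
    case (Suc n)
    with that assms(1) show ?case
      by (auto simp: scale number_generator disjoint_iff)
  qed (use that assms(2) in simp)
  then have fixn: "foldr number qs (generator hs ps ((?G ^^ n) v)) = generator hs ps ((?G ^^ n) v)" for n
    using assms(1) by (intro fixp) (auto simp: number_generator disjoint_iff)
  have "(?C ^^ n) v = (?G ^^ n) v" for n
    by (induction n) (simp_all add: fixn)
  then show ?thesis
    by (simp add: controlled_ucc_def ucc_def op_exp_def)
qed

lemma controlled_ucc_empty:
  assumes "set qs \<inter> (set hs \<union> set ps) = {}" "q \<in> set qs" "number q v = 0"
  shows "controlled_ucc qs hs ps \<theta> v = v"
proof -
  let ?C = "\<lambda>v. \<theta> *\<^sub>R foldr number qs (generator hs ps v)"
  have nth: "foldr number xs u $ S = (if set xs \<subseteq> S then u $ S else 0)" for xs S and u :: "'a fock"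
    by (induction xs) (auto simp: number_nth)
  have gen: "generator hs ps v $ S = 0" if "q \<in> S" for S
  proof -
    have "number q (generator hs ps v) = generator hs ps 0"
      using assms by (subst number_generator) auto
    then have "number q (generator hs ps v) = 0"
      by (simp add: linear_0 linear_generator)
    then show ?thesis
      using that number_nth[of q "generator hs ps v" S] by simp
  qed
  have C: "?C v = 0"
    using assms(2) gen by (auto simp: vec_eq_iff nth)
  have z: "?C 0 = 0"
    by (simp add: linear_0[OF linear_generator] vec_eq_iff nth)
  have "(?C ^^ Suc n) v = 0" for n
    by (induction n) (use C z in auto)
  then have "(?C ^^ n) v /\<^sub>R fact n = (if n = 0 then v else 0)" for n
    by (cases n) auto
  then show ?thesis
    using sums_If_finite_set[of "{0}" "\<lambda>_. v"]
    by (simp add: controlled_ucc_def op_exp_def sums_unique[symmetric])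
qed

end

(*
  A UCC factor acts on determinants as a plane rotation: if a generator G sends u to v and v to -u,
  then exp(t G) u = cos t u + sin t v; determinants on which neither the excitation nor the
  de-excitation can act are fixed. At angle pi/2 the rotation is a swap, so the first two factors
  move a b to w eta1 and c to eta2. The controlled double factor then rotates eta1 eta2 into x y, and
  the last two factors undo the swaps. The control on w is what protects the component c phi2 phi3
  (temporarily eta2 phi2 phi3), and the empty eta2 what protects a b phi1 (temporarily w eta1 phi1).
*)
theory Submission
  imports Defs
begin

section \<open>Exponentials of linear operators\<close>

lemma op_exp_commute:
  fixes X L :: "'v::euclidean_space \<Rightarrow> 'v"
  assumes "linear X" "linear L" "\<And>v. X (L v) = L (X v)"
  shows "op_exp X (L v) = L (op_exp X v)"
proof -
  have "(X ^^ n) (L v) = L ((X ^^ n) v)" for n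
    by (induction n) (simp_all add: assms(3))
  \<comment> \<open>In finite dimension \<open>L\<close> is bounded, so it may be taken out of the
    series term by term.\<close>
  then have "(\<lambda>n. (X ^^ n) (L v) /\<^sub>R fact n) sums L (op_exp X v)"
    using bounded_linear.sums[OF linear_conv_bounded_linear[THEN iffD1, OF assms(2)] op_exp_sums[OF assms(1)]]
    by (simp add: linear_scale[OF assms(2)])
  then show ?thesis
    using op_exp_sums[OF assms(1)] sums_unique2 by blast
qed

lemma linear_op_exp:
  fixes X :: "'v::euclidean_space \<Rightarrow> 'v"
  assumes "linear X"
  shows "linear (op_exp X)"
proof (rule linearI)
  fix u v
  have "linear (X ^^ n)" for n
    by (induction n) (simp_all add: linear_id linear_compose assms del: id_apply o_apply)
  then have "(\<lambda>n. (X ^^ n) (u + v) /\<^sub>R fact n) sums (op_exp X u + op_exp X v)"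
    using sums_add[OF op_exp_sums[OF assms, of u] op_exp_sums[OF assms, of v]]
    by (simp add: linear_add scaleR_add_right)
  then show "op_exp X (u + v) = op_exp X u + op_exp X v"
    using op_exp_sums[OF assms] sums_unique2 by blast
next
  fix r v
  show "op_exp X (r *\<^sub>R v) = r *\<^sub>R op_exp X v"
    by (rule op_exp_commute) (simp_all add: assms linear_scale)
qed

text \<open>The powers of \<open>X\<close> cycle through u, v, -u, -v with growing powers of t, so
  the even and odd terms of the exponential series are the cosine and sine series.\<close>

lemma op_exp_rotation:
  fixes X :: "'v::euclidean_space \<Rightarrow> 'v"
  assumes "linear X" "X u = t *\<^sub>R v" "X v = - (t *\<^sub>R u)"
  shows "op_exp X u = cos t *\<^sub>R u + sin t *\<^sub>R v"
proof -
  have eq: "(X ^^ n) u /\<^sub>R fact n = (cos_coeff n *\<^sub>R t ^ n) *\<^sub>R u + (sin_coeff n *\<^sub>R t ^ n) *\<^sub>R v" for n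
  proof (induction n)
    case (Suc n)
    have "(X ^^ Suc n) u /\<^sub>R fact (Suc n) = X ((X ^^ n) u /\<^sub>R fact n) /\<^sub>R real (Suc n)"
      by (simp add: linear_scale[OF assms(1)] mult.commute)
    also have "\<dots> = ((cos_coeff n * t ^ n) *\<^sub>R (t *\<^sub>R v) - (sin_coeff n * t ^ n) *\<^sub>R (t *\<^sub>R u)) /\<^sub>R real (Suc n)"
      unfolding Suc.IH by (simp add: linear_add[OF assms(1)] linear_scale[OF assms(1)] assms(2,3))
    \<comment> \<open>The recurrences \<open>cos_coeff (Suc n) = - sin_coeff n / Suc n\<close> and
      \<open>sin_coeff (Suc n) = cos_coeff n / Suc n\<close> absorb both the sign and the new
      divisor.\<close>
    also have "\<dots> = (cos_coeff (Suc n) *\<^sub>R t ^ Suc n) *\<^sub>R u + (sin_coeff (Suc n) *\<^sub>R t ^ Suc n) *\<^sub>R v"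
      by (simp add: cos_coeff_Suc sin_coeff_Suc scaleR_diff_right divide_inverse mult_ac)
    finally show ?case .
  qed simp
  have "(\<lambda>n. (X ^^ n) u /\<^sub>R fact n) sums (cos t *\<^sub>R u + sin t *\<^sub>R v)"
    unfolding eq
    by (intro sums_add bounded_linear.sums[OF bounded_linear_scaleR_left] cos_converges sin_converges)
  then show ?thesis
    using op_exp_sums[OF assms(1)] sums_unique2 by blast
qed

section \<open>Ladder operators on determinants\<close>

lemma ket_Cons: "ket (p # ps) = create p (ket ps)"
  by (simp add: ket_def)

lemma ket_append: "ket (ps @ qs) = foldr create ps (ket qs)"
  by (simp add: ket_def)

lemma ket_swap: "ket (p # q # ps) = - ket (q # p # ps)"
  using anticomm_create[of p q "ket ps"] by (simp add: ket_Cons eq_neg_iff_add_eq_0)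

text \<open>A 3-cycle is two transpositions, so no sign appears. This brings active orbitals to the
  front of a ket, where \<open>ucc_ket\<close> expects them.\<close>

lemma ket_rotate3: "ket [p, q, r] = ket [q, r, p]"
  using ket_swap[of p q "[r]"] ket_swap[of p r "[]"]
  by (simp add: ket_Cons[of q] linear_neg[OF linear_create])

text \<open>The annihilator anticommutes past every creator and finally meets the vacuum.\<close>

lemma annihilate_ket_unoccupied: "p \<notin> set qs \<Longrightarrow> annihilate p (ket qs) = 0"
proof (induction qs)
  case (Cons q qs)
  with anticomm_annihilate_create[of p q "ket qs"] show ?case
    by (simp add: ket_Cons linear_0[OF linear_create])
qed (simp add: ket_def)

lemma annihilate_ket_Cons: "p \<notin> set qs \<Longrightarrow> annihilate p (ket (p # qs)) = ket qs"
  using anticomm_annihilate_create[of p p "ket qs"]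
  by (simp add: ket_Cons annihilate_ket_unoccupied linear_0[OF linear_create])

lemma number_ket_unoccupied: "q \<notin> set ps \<Longrightarrow> number q (ket ps) = 0"
  by (simp add: number_def annihilate_ket_unoccupied linear_0[OF linear_create])

lemma number_ket_Cons: "q \<notin> set ps \<Longrightarrow> number q (ket (q # ps)) = ket (q # ps)"
  by (simp add: number_def annihilate_ket_Cons) (simp add: ket_Cons)

text \<open>The reversed order makes the first listed orbital go first, so each annihilator meets
  its creator at the head and no sign arises.\<close>

lemma foldr_annihilate_ket:
  "distinct (hs @ rs) \<Longrightarrow> foldr annihilate (rev hs) (ket (hs @ rs)) = ket rs"
  by (induction hs) (simp_all add: annihilate_ket_Cons)

lemma foldr_annihilate_unoccupied:
  assumes "annihilate h v = 0"
  shows "h \<in> set xs \<Longrightarrow> foldr annihilate xs v = 0"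
proof (induction xs)
  case (Cons p xs)
  \<comment> \<open>Anticommutation moves \<open>annihilate h\<close> through the string
    \<open>ys\<close> until it reaches \<open>v\<close>.\<close>
  have "annihilate h (foldr annihilate ys v) = 0" for ys
  proof (induction ys)
    case (Cons q ys)
    then show ?case
      using anticomm_annihilate[of h q "foldr annihilate ys v"]
      by (simp add: linear_0[OF linear_annihilate])
  qed (simp add: assms)
  with Cons show ?case
    by (auto simp: linear_0[OF linear_annihilate])
qed simp

section \<open>Excitations, generators and UCC factors on determinants\<close>

lemma excite_ket: "distinct (hs @ rs) \<Longrightarrow> excite hs ps (ket (hs @ rs)) = ket (ps @ rs)"
  unfolding excite_def foldr_annihilate_ket by (simp add: ket_append)

lemma excite_ket_unoccupied:
  assumes "\<not> set hs \<subseteq> set qs"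
  shows "excite hs ps (ket qs) = 0"
proof -
  obtain h where h: "h \<in> set hs" "h \<notin> set qs"
    using assms by blast
  have "foldr create ps 0 = (0 :: 'a fock)"
    by (induction ps) (simp_all add: linear_0[OF linear_create])
  then show ?thesis
    using h foldr_annihilate_unoccupied[OF annihilate_ket_unoccupied, of h qs "rev hs"]
    by (simp add: excite_def)
qed

lemma generator_commute: "generator ps hs v = - generator hs ps v"
  by (simp add: generator_def adjoint_excite)

lemma generator_ket:
  assumes "distinct (hs @ ps @ rs)" "ps \<noteq> []"
  shows "generator hs ps (ket (hs @ rs)) = ket (ps @ rs)"
proof -
  \<comment> \<open>The de-excitation must annihilate an orbital of the nonempty list
    \<open>ps\<close>, all of which are empty here.\<close>
  have "excite ps hs (ket (hs @ rs)) = 0"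
    using assms by (intro excite_ket_unoccupied) (cases ps; auto)
  moreover have "distinct (hs @ rs)"
    using assms(1) by auto
  ultimately show ?thesis
    by (simp add: generator_def adjoint_excite excite_ket del: distinct_append)
qed

lemma generator_ket_unoccupied:
  "\<not> set hs \<subseteq> set qs \<Longrightarrow> \<not> set ps \<subseteq> set qs \<Longrightarrow> generator hs ps (ket qs) = 0"
  by (simp add: generator_def adjoint_excite excite_ket_unoccupied)

text \<open>\<open>linear\<close> covers real scalars only, while the amplitudes of the state are
  complex; hence the separate \<open>*s\<close> rules here and below.\<close>

lemma excite_scale: "excite hs ps (z *s v) = z *s excite hs ps v"
proof -
  have "foldr annihilate xs (z *s u) = z *s foldr annihilate xs u" for xs and u :: "'a fock"
    by (induction xs) (simp_all add: annihilate_scale)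
  moreover have "foldr create xs (z *s u) = z *s foldr create xs u" for xs and u :: "'a fock"
    by (induction xs) (simp_all add: create_scale)
  ultimately show ?thesis
    by (simp add: excite_def)
qed

lemma generator_scale: "generator hs ps (z *s v) = z *s generator hs ps v"
  by (simp add: generator_def adjoint_excite excite_scale vector_ssub_ldistrib)

lemma linear_vector_scalar_mult: "linear (\<lambda>v :: complex ^ 'n. z *s v)"
  by (rule linearI) (simp_all add: vec_eq_iff algebra_simps)

lemma linear_scaled_generator: "linear (\<lambda>v. t *\<^sub>R generator hs ps v)"
  by (intro linear_compose_scale_right linear_generator)

lemma linear_foldr_number: "linear (foldr number qs)"
proof (induction qs)
  case (Cons q qs)
  have "linear (number q)"
    by (rule linearI) (simp_all add: vec_eq_iff number_nth)
  with Cons show ?case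
    by (simp add: linear_compose del: o_apply)
qed (simp add: linear_id del: id_apply)

lemma linear_controlled_generator: "linear (\<lambda>v. t *\<^sub>R foldr number qs (generator hs ps v))"
  using linear_compose[OF linear_generator linear_foldr_number]
  by (intro linear_compose_scale_right) (simp add: o_def)

lemma linear_ucc: "linear (ucc hs ps t)"
  unfolding ucc_def by (intro linear_op_exp linear_scaled_generator)

lemma linear_controlled_ucc: "linear (controlled_ucc qs hs ps t)"
  unfolding controlled_ucc_def by (intro linear_op_exp linear_controlled_generator)

lemma ucc_scale: "ucc hs ps t (z *s v) = z *s ucc hs ps t v"
  unfolding ucc_def
  by (rule op_exp_commute[OF linear_scaled_generator linear_vector_scalar_mult])
    (simp add: generator_scale linear_scale[OF linear_vector_scalar_mult])

lemma controlled_ucc_scale: "controlled_ucc qs hs ps t (z *s v) = z *s controlled_ucc qs hs ps t v"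
proof -
  have "foldr number qs (z *s u) = z *s foldr number qs u" for u :: "'a fock"
    by (induction qs) (simp_all add: number_def annihilate_scale create_scale)
  then show ?thesis
    unfolding controlled_ucc_def
    by (intro op_exp_commute[OF linear_controlled_generator linear_vector_scalar_mult])
      (simp add: generator_scale linear_scale[OF linear_vector_scalar_mult])
qed

lemma ucc_commute: "ucc ps hs t = ucc hs ps (- t)"
  by (simp add: ucc_def generator_commute[of ps hs])

text \<open>The generator sends the first determinant to the second and the second to minus the
  first, as \<open>op_exp_rotation\<close> requires.\<close>

lemma ucc_ket:
  assumes "distinct (hs @ ps @ rs)" "hs \<noteq> []" "ps \<noteq> []"
  shows "ucc hs ps t (ket (hs @ rs)) = cos t *\<^sub>R ket (hs @ rs) + sin t *\<^sub>R ket (ps @ rs)"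
proof -
  have "distinct (ps @ hs @ rs)"
    using assms(1) by auto
  then have "generator hs ps (ket (ps @ rs)) = - ket (hs @ rs)"
    using generator_ket[of ps hs rs] assms(2) generator_commute[of hs ps] by simp
  then show ?thesis
    unfolding ucc_def using generator_ket[OF assms(1,3)]
    by (intro op_exp_rotation linear_scaled_generator) simp_all
qed

text \<open>Exchanging the two index lists negates the generator, so this is \<open>ucc_ket\<close>
  read at angle -t.\<close>

lemma ucc_ket_excited:
  assumes "distinct (hs @ ps @ rs)" "hs \<noteq> []" "ps \<noteq> []"
  shows "ucc hs ps t (ket (ps @ rs)) = cos t *\<^sub>R ket (ps @ rs) - sin t *\<^sub>R ket (hs @ rs)"
proof -
  have "distinct (ps @ hs @ rs)"
    using assms(1) by auto
  then show ?thesis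
    using ucc_ket[of ps hs rs "- t"] assms(2,3) by (simp add: ucc_commute[of hs ps])
qed

lemma ucc_ket_unoccupied:
  assumes "\<not> set hs \<subseteq> set qs" "\<not> set ps \<subseteq> set qs"
  shows "ucc hs ps t (ket qs) = ket qs"
  \<comment> \<open>A vector killed by the generator counts as rotated by angle 0, with an arbitrary
    partner vector.\<close>
  using op_exp_rotation[OF linear_scaled_generator, of t hs ps "ket qs" 0 "ket qs"]
  by (simp add: ucc_def generator_ket_unoccupied[OF assms])

section \<open>The five factors followed on each determinant of the state\<close>

theorem mainTheorem2:
  fixes a b c w x y \<eta>\<^sub>1 \<eta>\<^sub>2 \<phi>\<^sub>1 \<phi>\<^sub>2 \<phi>\<^sub>3 :: "'o::{finite,linorder}"
    and \<theta> :: real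
    and \<xi>\<^sub>1 \<xi>\<^sub>2 \<xi>\<^sub>3 \<xi>\<^sub>4 :: complex
    and \<Psi> :: "'o fock"
  assumes "distinct [a, b, c, w, x, y, \<eta>\<^sub>1, \<eta>\<^sub>2]"
    and "{\<phi>\<^sub>1, \<phi>\<^sub>2, \<phi>\<^sub>3} \<inter> {a, b, c, w, x, y, \<eta>\<^sub>1, \<eta>\<^sub>2} = {}"
    and "\<phi>\<^sub>2 \<noteq> \<phi>\<^sub>3"
    and "\<Psi> = \<xi>\<^sub>1 *s ket [a, b, c] + \<xi>\<^sub>2 *s ket [a, b, \<phi>\<^sub>1]
           + \<xi>\<^sub>3 *s ket [c, \<phi>\<^sub>2, \<phi>\<^sub>3] + \<xi>\<^sub>4 *s ket [w, x, y]"
  shows "(ucc [w, \<eta>\<^sub>1] [a, b] (pi / 2) \<circ> ucc [\<eta>\<^sub>2] [c] (pi / 2)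
            \<circ> controlled_ucc [w] [\<eta>\<^sub>1, \<eta>\<^sub>2] [x, y] \<theta>
            \<circ> ucc [c] [\<eta>\<^sub>2] (pi / 2) \<circ> ucc [a, b] [w, \<eta>\<^sub>1] (pi / 2)) \<Psi>
         = op_exp (\<lambda>v. \<theta> *\<^sub>R (excite [a, b, c] [w, x, y] v - adjoint (excite [a, b, c] [w, x, y]) v)) \<Psi>
       \<and> op_exp (\<lambda>v. \<theta> *\<^sub>R (excite [a, b, c] [w, x, y] v - adjoint (excite [a, b, c] [w, x, y]) v)) \<Psi>
         = \<xi>\<^sub>1 *s (cos \<theta> *\<^sub>R ket [a, b, c] + sin \<theta> *\<^sub>R ket [w, x, y])
           + \<xi>\<^sub>2 *s ket [a, b, \<phi>\<^sub>1] + \<xi>\<^sub>3 *s ket [c, \<phi>\<^sub>2, \<phi>\<^sub>3]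
           + \<xi>\<^sub>4 *s (cos \<theta> *\<^sub>R ket [w, x, y] - sin \<theta> *\<^sub>R ket [a, b, c])"
proof -
  note dist = assms(1,2)
  note lin = linear_add[OF linear_ucc] linear_diff[OF linear_ucc] linear_scale[OF linear_ucc] ucc_scale
    linear_add[OF linear_controlled_ucc] linear_scale[OF linear_controlled_ucc] controlled_ucc_scale
  let ?T = "ucc [a, b, c] [w, x, y] \<theta>"
  let ?R = "\<xi>\<^sub>1 *s (cos \<theta> *\<^sub>R ket [a, b, c] + sin \<theta> *\<^sub>R ket [w, x, y])
           + \<xi>\<^sub>2 *s ket [a, b, \<phi>\<^sub>1] + \<xi>\<^sub>3 *s ket [c, \<phi>\<^sub>2, \<phi>\<^sub>3]
           + \<xi>\<^sub>4 *s (cos \<theta> *\<^sub>R ket [w, x, y] - sin \<theta> *\<^sub>R ket [a, b, c])"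
  have T: "op_exp (\<lambda>v. \<theta> *\<^sub>R (excite [a, b, c] [w, x, y] v - adjoint (excite [a, b, c] [w, x, y]) v)) = ?T"
    by (simp add: ucc_def generator_def)
  have triple: "?T \<Psi> = ?R"
  proof -
    have "?T (ket [a, b, c]) = cos \<theta> *\<^sub>R ket [a, b, c] + sin \<theta> *\<^sub>R ket [w, x, y]"
      using ucc_ket[of "[a, b, c]" "[w, x, y]" "[]" \<theta>] dist by simp
    moreover have "?T (ket [w, x, y]) = cos \<theta> *\<^sub>R ket [w, x, y] - sin \<theta> *\<^sub>R ket [a, b, c]"
      using ucc_ket_excited[of "[a, b, c]" "[w, x, y]" "[]" \<theta>] dist by simp
    moreover have "?T (ket [a, b, \<phi>\<^sub>1]) = ket [a, b, \<phi>\<^sub>1]" "?T (ket [c, \<phi>\<^sub>2, \<phi>\<^sub>3]) = ket [c, \<phi>\<^sub>2, \<phi>\<^sub>3]"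
      using dist by (auto intro!: ucc_ket_unoccupied)
    ultimately show ?thesis
      by (simp add: assms(4) lin)
  qed
  let ?U1 = "ucc [a, b] [w, \<eta>\<^sub>1] (pi / 2)"
  \<comment> \<open>At angle pi/2 the cosine vanishes and the sine is 1, so one determinant is
    replaced by the other with a plus sign.\<close>
  have U1: "?U1 (ket [a, b, c]) = ket [w, \<eta>\<^sub>1, c]" "?U1 (ket [a, b, \<phi>\<^sub>1]) = ket [w, \<eta>\<^sub>1, \<phi>\<^sub>1]"
    using ucc_ket[of "[a, b]" "[w, \<eta>\<^sub>1]" "[c]" "pi / 2"] ucc_ket[of "[a, b]" "[w, \<eta>\<^sub>1]" "[\<phi>\<^sub>1]" "pi / 2"] dist
    by auto
  have U1_id: "?U1 (ket [c, \<phi>\<^sub>2, \<phi>\<^sub>3]) = ket [c, \<phi>\<^sub>2, \<phi>\<^sub>3]" "?U1 (ket [w, x, y]) = ket [w, x, y]"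
    using dist by (auto intro!: ucc_ket_unoccupied)
  have single: "ucc [p] [q] (pi / 2) (ket [p, r, s]) = ket [q, r, s]" if "distinct [p, q, r, s]" for p q r s :: 'o
    using ucc_ket[of "[p]" "[q]" "[r, s]" "pi / 2"] that by auto
  let ?U2 = "ucc [c] [\<eta>\<^sub>2] (pi / 2)"
  have U2_phi: "?U2 (ket [c, \<phi>\<^sub>2, \<phi>\<^sub>3]) = ket [\<eta>\<^sub>2, \<phi>\<^sub>2, \<phi>\<^sub>3]"
    using dist assms(3) by (intro single) auto
  \<comment> \<open>The active orbital stands last; the sign-free rotation puts it first so that
    \<open>single\<close> applies, and then back.\<close>
  have U2: "?U2 (ket [w, \<eta>\<^sub>1, c]) = ket [w, \<eta>\<^sub>1, \<eta>\<^sub>2]"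
    using single[of c \<eta>\<^sub>2 w \<eta>\<^sub>1] dist by (auto simp: ket_rotate3[of c] ket_rotate3[of \<eta>\<^sub>2])
  have U2_id: "?U2 (ket [w, \<eta>\<^sub>1, \<phi>\<^sub>1]) = ket [w, \<eta>\<^sub>1, \<phi>\<^sub>1]" "?U2 (ket [w, x, y]) = ket [w, x, y]"
    using dist by (auto intro!: ucc_ket_unoccupied)
  let ?C = "controlled_ucc [w] [\<eta>\<^sub>1, \<eta>\<^sub>2] [x, y] \<theta>"
  have control: "?C (ket [w, p, q]) = ucc [\<eta>\<^sub>1, \<eta>\<^sub>2] [x, y] \<theta> (ket [w, p, q])" if "w \<noteq> p" "w \<noteq> q" for p q
    using dist that by (intro controlled_ucc_occupied) (auto simp: number_ket_Cons)
  have C: "?C (ket [w, \<eta>\<^sub>1, \<eta>\<^sub>2]) = cos \<theta> *\<^sub>R ket [w, \<eta>\<^sub>1, \<eta>\<^sub>2] + sin \<theta> *\<^sub>R ket [w, x, y]"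
    "?C (ket [w, x, y]) = cos \<theta> *\<^sub>R ket [w, x, y] - sin \<theta> *\<^sub>R ket [w, \<eta>\<^sub>1, \<eta>\<^sub>2]"
    using ucc_ket[of "[\<eta>\<^sub>1, \<eta>\<^sub>2]" "[x, y]" "[w]" \<theta>] ucc_ket_excited[of "[\<eta>\<^sub>1, \<eta>\<^sub>2]" "[x, y]" "[w]" \<theta>] dist
    by (auto simp: control) (auto simp: ket_rotate3[of w])
  \<comment> \<open>The control \<open>w\<close> is occupied here, but \<open>\<eta>\<^sub>2\<close>
    and \<open>x\<close> are empty, so neither pair can be annihilated.\<close>
  have C_id: "?C (ket [w, \<eta>\<^sub>1, \<phi>\<^sub>1]) = ket [w, \<eta>\<^sub>1, \<phi>\<^sub>1]"
  proof -
    have "ucc [\<eta>\<^sub>1, \<eta>\<^sub>2] [x, y] \<theta> (ket [w, \<eta>\<^sub>1, \<phi>\<^sub>1]) = ket [w, \<eta>\<^sub>1, \<phi>\<^sub>1]"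
      using dist by (intro ucc_ket_unoccupied) auto
    then show ?thesis
      using dist by (subst control) auto
  qed
  have C_unoccupied: "?C (ket [\<eta>\<^sub>2, \<phi>\<^sub>2, \<phi>\<^sub>3]) = ket [\<eta>\<^sub>2, \<phi>\<^sub>2, \<phi>\<^sub>3]"
    using dist by (intro controlled_ucc_empty[where q = w]) (auto intro!: number_ket_unoccupied)
  \<comment> \<open>Exchanging upper and lower indices inverts a factor, so \<open>?U4\<close> and
    \<open>?U5\<close> undo \<open>?U2\<close> and \<open>?U1\<close>.\<close>
  let ?U4 = "ucc [\<eta>\<^sub>2] [c] (pi / 2)"
  have U4: "?U4 (ket [w, \<eta>\<^sub>1, \<eta>\<^sub>2]) = ket [w, \<eta>\<^sub>1, c]" "?U4 (ket [\<eta>\<^sub>2, \<phi>\<^sub>2, \<phi>\<^sub>3]) = ket [c, \<phi>\<^sub>2, \<phi>\<^sub>3]"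
    using single[of \<eta>\<^sub>2 c w \<eta>\<^sub>1] single[of \<eta>\<^sub>2 c \<phi>\<^sub>2 \<phi>\<^sub>3] dist assms(3)
    by (auto simp: ket_rotate3[of c w] ket_rotate3[of \<eta>\<^sub>2 w])
  have U4_id: "?U4 (ket [w, \<eta>\<^sub>1, \<phi>\<^sub>1]) = ket [w, \<eta>\<^sub>1, \<phi>\<^sub>1]" "?U4 (ket [w, x, y]) = ket [w, x, y]"
    using dist by (auto intro!: ucc_ket_unoccupied)
  let ?U5 = "ucc [w, \<eta>\<^sub>1] [a, b] (pi / 2)"
  have U5: "?U5 (ket [w, \<eta>\<^sub>1, c]) = ket [a, b, c]" "?U5 (ket [w, \<eta>\<^sub>1, \<phi>\<^sub>1]) = ket [a, b, \<phi>\<^sub>1]"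
    using ucc_ket[of "[w, \<eta>\<^sub>1]" "[a, b]" "[c]" "pi / 2"] ucc_ket[of "[w, \<eta>\<^sub>1]" "[a, b]" "[\<phi>\<^sub>1]" "pi / 2"] dist
    by auto
  have U5_id: "?U5 (ket [c, \<phi>\<^sub>2, \<phi>\<^sub>3]) = ket [c, \<phi>\<^sub>2, \<phi>\<^sub>3]" "?U5 (ket [w, x, y]) = ket [w, x, y]"
    using dist by (auto intro!: ucc_ket_unoccupied)
  \<comment> \<open>By linearity it suffices to chain the images of the four kets. In the
    superpositions made by \<open>?C\<close>, the last two factors return
    \<open>ket [w, \<eta>\<^sub>1, \<eta>\<^sub>2]\<close> to \<open>ket [a, b, c]\<close> and fix
    \<open>ket [w, x, y]\<close>.\<close>
  have "(?U5 \<circ> ?U4 \<circ> ?C \<circ> ?U2 \<circ> ?U1) \<Psi> = ?R"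
    by (simp add: assms(4) lin linear_diff[OF linear_controlled_ucc] U1 U1_id U2_phi U2 U2_id C C_id C_unoccupied U4 U4_id U5 U5_id)
  with triple show ?thesis
    unfolding T by simp
qed

end
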